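(* (i) For every triangle $K$, the parameters $\alpha_{ij},\beta_{ij},\gamma_{ij}$, $(i,j)\in\{(1,2),(2,3),(3,1)\}$, in the definition of the functions $$\Phi_{ij}=\lambda_i\nabla\lambda_j-\lambda_j\nabla\lambda_i+\alpha_{ij}\Phi^B_{ij}+\beta_{ij}\Phi^B_{jk}+\gamma_{ij}\Phi^B_{ki},\qquad \Phi^B_{ij}=\lambda_i\lambda_j\nabla\lambda_k,$$ where $k$ denotes the third index, can be chosen such that the normal component of each $\Phi_{ij}$ with respect to each edge of $K$ vanishes at the midpoint of that edge. With this choice, the local mass matrix on $K$, i.e. the Gram matrix of $\Phi_{12},\Phi_{23},\Phi_{31},\Phi^B_{12},\Phi^B_{23},\Phi^B_{31}$ with respect to $(\cdot,\cdot)_{h,K}$, is diagonal. (ii) For every rectangle $K$, the local mass matrix, i.e. the Gram matrix of the standard basis $\Phi_{h,1},\Phi_{h,2},\Phi_{v,1},\Phi_{v,2}$ of $\mathcal N_0(K)$ with respect to $(\cdot,\cdot)_{h,K}$, is diagonal. (iii) Consequently, the global mass matrix, i.e. the Gram matrix of the global basis of $\mathcal V_h$ assembled from these local basis functions with respect to $(\cdot,\cdot)_h$, is diagonal.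
   Context: Mesh. $\Omega\subset\mathbb R^2$ is a bounded Lipschitz polygon and $\mathcal T_h=\{K\}$ is a partition of $\Omega$ into (nondegenerate) triangles and/or axis-parallel rectangles (edges horizontal and vertical), where different elements meet only at common vertices or common whole edges. $\operatorname{curl}E=\partial_xE_2-\partial_yE_1$ and $H(\operatorname{curl};\Omega)=\{v\in L^2(\Omega)^2:\operatorname{curl}v\in L^2(\Omega)\}$. Local spaces. The lowest order Nédélec space is $\mathcal N_0(K)=\{(a-by,\,c+bx):a,b,c\in\mathbb R\}$ on a triangle and $\mathcal N_0(K)=\{(a+by,\,c+dx):a,b,c,d\in\mathbb R\}$ on a rectangle. On a triangle, $\lambda_1,\lambda_2,\lambda_3$ are the barycentric coordinates, the edge $e_k=e_{ij}$ joins vertices $i$ and $j$ and is opposite to vertex $k$, and $\mathcal N_0^+(K)=\mathcal N_0(K)+\operatorname{span}\{\Phi^B_{12},\Phi^B_{23},\Phi^B_{31}\}=\operatorname{span}\{\Phi_{12},\Phi_{23},\Phi_{31},\Phi^B_{12},\Phi^B_{23},\Phi^B_{31}\}$; indices are cyclic, i.e. $(i,j,k)$ is one of $(1,2,3),(2,3,1),(3,1,2)$. On a rectangle with horizontal edges $e_{h,1},e_{h,2}$ and vertical edges $e_{v,1},e_{v,2}$, the standard basis function $\Phi_{h,i}\in\mathcal N_0(K)$ has vanishing second component, tangential integral $1$ along $e_{h,i}$, and vanishes identically on the opposite horizontal edge; analogously $\Phi_{v,j}\in\mathcal N_0(K)$ has vanishing first component, tangential integral $1$ along $e_{v,j}$,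 and vanishes on the opposite vertical edge. Global space. $V(K)=\mathcal N_0(K)$ on rectangles, $V(K)=\mathcal N_0^+(K)$ on triangles, and $\mathcal V_h=\{v_h\in H(\operatorname{curl};\Omega):v_h|_K\in V(K)\ \forall K\in\mathcal T_h\}$. The global basis consists of: for each mesh edge $e$ with a fixed orientation, the function whose restriction to each element $K$ having $e$ as an edge is, up to sign, the local edge basis function ($\Phi_{ij}$, $\Phi_{h,i}$ or $\Phi_{v,j}$) associated with $e$, with the sign chosen so that its tangential integral along the oriented edge $e$ is $1$, and which is zero on all other elements; and for each triangle $K$, the three functions $\Phi^B_{12},\Phi^B_{23},\Phi^B_{31}$ of $K$ extended by zero. Quadrature. $(u,v)_h=\sum_{K\in\mathcal T_h}(u,v)_{h,K}$. On a triangle, $(u,v)_{h,K}=|K|\sum_{i=1}^3\frac13u(m_{K,i})\cdot v(m_{K,i})$, where $m_{K,i}$ is the midpoint of the edge opposite vertex $i$. On a rectangle, $(u,v)_{h,K}=|K|\big(\sum_{i=1}^2\frac12u_1(m_{K,h,i})v_1(m_{K,h,i})+\sum_{j=1}^2\frac12u_2(m_{K,v,j})v_2(m_{K,v,j})\big)$, where $m_{K,h,i}$ and $m_{K,v,j}$ are the midpoints of the horizontal and vertical edges, respectively. Point values are taken from the polynomial $u|_K$, $v|_K$. *)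

theory Defs
  imports "HOL-Analysis.Analysis"
begin

type_synonym vfield = "real^2 \<Rightarrow> real^2"

definition grad :: "(real^2 \<Rightarrow> real) \<Rightarrow> vfield" where
  "grad f x = (THE D. GDERIV f x :> D)"

definition tangential_integral :: "(real^2) \<times> (real^2) \<Rightarrow> vfield \<Rightarrow> real" where
  "tangential_integral pq F =
     integral {0..1} (\<lambda>t. F (linepath (fst pq) (snd pq) t) \<bullet> (snd pq - fst pq))"

definition gram :: "('u \<Rightarrow> 'u \<Rightarrow> real) \<Rightarrow> ('i \<Rightarrow> 'u) \<Rightarrow> 'i \<Rightarrow> 'i \<Rightarrow> real" where
  "gram B \<phi> i j = B (\<phi> i) (\<phi> j)"

definition diagonal_on :: "'i set \<Rightarrow> ('i \<Rightarrow> 'i \<Rightarrow> real) \<Rightarrow> bool" where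
  "diagonal_on I A \<longleftrightarrow> (\<forall>i\<in>I. \<forall>j\<in>I. i \<noteq> j \<longrightarrow> A i j = 0)"


text \<open>
  A triangle is given by its numbered vertices. Arithmetic in the index type \<open>3\<close> is modulo 3,
  so \<open>(i, i + 1, i + 2)\<close> runs through the cyclic triples (1,2,3), (2,3,1), (3,1,2). Families
  indexed by the pairs \<open>(i,j)\<close> = (1,2), (2,3), (3,1) are indexed by \<open>i\<close>, with \<open>j = i + 1\<close> and
  \<open>k = i + 2\<close>.
\<close>

definition nondegenerate :: "real^2^3 \<Rightarrow> bool" where
  "nondegenerate v \<longleftrightarrow> \<not> collinear (range (($) v))"

definition bary :: "real^2^3 \<Rightarrow> 3 \<Rightarrow> real^2 \<Rightarrow> real" where
  "bary v i x =
     (THE l :: real^3. (\<Sum>j\<in>UNIV. l$j) = 1 \<and> (\<Sum>j\<in>UNIV. l$j *\<^sub>R v$j) = x) $ i"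

definition tri_edge :: "real^2^3 \<Rightarrow> 3 \<Rightarrow> (real^2) \<times> (real^2)" where
  "tri_edge v i = (v$i, v$(i + 1))"

definition tri_midpoint :: "real^2^3 \<Rightarrow> 3 \<Rightarrow> real^2" where
  "tri_midpoint v i = midpoint (v$(i + 1)) (v$(i + 2))"

definition tri_bubble :: "real^2^3 \<Rightarrow> 3 \<Rightarrow> vfield" where
  "tri_bubble v i x = (bary v i x * bary v (i + 1) x) *\<^sub>R grad (bary v (i + 2)) x"

definition tri_edge_fun ::
  "real^2^3 \<Rightarrow> (3 \<Rightarrow> real) \<Rightarrow> (3 \<Rightarrow> real) \<Rightarrow> (3 \<Rightarrow> real) \<Rightarrow> 3 \<Rightarrow> vfield" where
  "tri_edge_fun v \<alpha> \<beta> \<gamma> i x =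
     bary v i x *\<^sub>R grad (bary v (i + 1)) x - bary v (i + 1) x *\<^sub>R grad (bary v i) x
     + \<alpha> i *\<^sub>R tri_bubble v i x + \<beta> i *\<^sub>R tri_bubble v (i + 1) x
     + \<gamma> i *\<^sub>R tri_bubble v (i + 2) x"

definition normal_components_vanish ::
  "real^2^3 \<Rightarrow> (3 \<Rightarrow> real) \<Rightarrow> (3 \<Rightarrow> real) \<Rightarrow> (3 \<Rightarrow> real) \<Rightarrow> bool" where
  "normal_components_vanish v \<alpha> \<beta> \<gamma> \<longleftrightarrow>
     (\<forall>i l n. norm n = 1 \<and> n \<bullet> (v$(l + 2) - v$(l + 1)) = 0 \<longrightarrow>
        tri_edge_fun v \<alpha> \<beta> \<gamma> i (tri_midpoint v l) \<bullet> n = 0)"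

datatype tri_dof = Tri_Edge 3 | Tri_Bubble 3

primrec tri_basis ::
  "real^2^3 \<Rightarrow> (3 \<Rightarrow> real) \<Rightarrow> (3 \<Rightarrow> real) \<Rightarrow> (3 \<Rightarrow> real) \<Rightarrow> tri_dof \<Rightarrow> vfield" where
  "tri_basis v \<alpha> \<beta> \<gamma> (Tri_Edge i) = tri_edge_fun v \<alpha> \<beta> \<gamma> i"
| "tri_basis v \<alpha> \<beta> \<gamma> (Tri_Bubble i) = tri_bubble v i"

definition N0_tri :: "vfield set" where
  "N0_tri = {u. \<exists>a b c. \<forall>x. u x = vector [a - b * x$2, c + b * x$1]}"

definition N0_plus :: "real^2^3 \<Rightarrow> vfield set" where
  "N0_plus v = {\<lambda>x. u x + (\<Sum>i\<in>UNIV. c i *\<^sub>R tri_bubble v i x) | u c. u \<in> N0_tri}"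


text \<open>
  A rectangle is given by its lower left corner \<open>a\<close> and its upper right corner \<open>b\<close>. Horizontal
  edges are numbered 1 (bottom), 2 (top), vertical edges 1 (left), 2 (right); in the index type
  \<open>2\<close> the number of the opposite edge is \<open>i + 1\<close>.
\<close>

definition proper_rect :: "real^2 \<Rightarrow> real^2 \<Rightarrow> bool" where
  "proper_rect a b \<longleftrightarrow> a$1 < b$1 \<and> a$2 < b$2"

datatype rect_dof = Hor 2 | Ver 2

primrec rect_edge :: "real^2 \<Rightarrow> real^2 \<Rightarrow> rect_dof \<Rightarrow> (real^2) \<times> (real^2)" where
  "rect_edge a b (Hor i) =
     (let y = (if i = 1 then a$2 else b$2) in (vector [a$1, y], vector [b$1, y]))"
| "rect_edge a b (Ver j) =
     (let x = (if j = 1 then a$1 else b$1) in (vector [x, a$2], vector [x, b$2]))"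

definition rect_midpoint :: "real^2 \<Rightarrow> real^2 \<Rightarrow> rect_dof \<Rightarrow> real^2" where
  "rect_midpoint a b d = midpoint (fst (rect_edge a b d)) (snd (rect_edge a b d))"

definition N0_rect :: "vfield set" where
  "N0_rect = {u. \<exists>a b c d. \<forall>x. u x = vector [a + b * x$2, c + d * x$1]}"

primrec rect_basis :: "real^2 \<Rightarrow> real^2 \<Rightarrow> rect_dof \<Rightarrow> vfield" where
  "rect_basis a b (Hor i) = (THE \<Phi>. \<Phi> \<in> N0_rect \<and> (\<forall>x. \<Phi> x $ 2 = 0) \<and>
     tangential_integral (rect_edge a b (Hor i)) \<Phi> = 1 \<and>
     (\<forall>x \<in> closed_segment (fst (rect_edge a b (Hor (i + 1)))) (snd (rect_edge a b (Hor (i + 1)))).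
        \<Phi> x = 0))"
| "rect_basis a b (Ver j) = (THE \<Phi>. \<Phi> \<in> N0_rect \<and> (\<forall>x. \<Phi> x $ 1 = 0) \<and>
     tangential_integral (rect_edge a b (Ver j)) \<Phi> = 1 \<and>
     (\<forall>x \<in> closed_segment (fst (rect_edge a b (Ver (j + 1)))) (snd (rect_edge a b (Ver (j + 1)))).
        \<Phi> x = 0))"


datatype element = Triangle "real^2^3" | Rectangle "real^2" "real^2"

primrec valid_element :: "element \<Rightarrow> bool" where
  "valid_element (Triangle v) = nondegenerate v"
| "valid_element (Rectangle a b) = proper_rect a b"

primrec region :: "element \<Rightarrow> (real^2) set" where
  "region (Triangle v) = convex hull (range (($) v))"
| "region (Rectangle a b) = cbox a b"

text \<open>A mesh edge is represented by the set of its two endpoints.\<close>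

definition endpoints :: "(real^2) \<times> (real^2) \<Rightarrow> (real^2) set" where
  "endpoints pq = {fst pq, snd pq}"

primrec edges :: "element \<Rightarrow> (real^2) set set" where
  "edges (Triangle v) = range (\<lambda>i. endpoints (tri_edge v i))"
| "edges (Rectangle a b) = range (\<lambda>d. endpoints (rect_edge a b d))"

definition vertices :: "element \<Rightarrow> (real^2) set" where
  "vertices K = \<Union> (edges K)"

primrec local_space :: "element \<Rightarrow> vfield set" where
  "local_space (Triangle v) = N0_plus v"
| "local_space (Rectangle a b) = N0_rect"

primrec local_quad :: "element \<Rightarrow> vfield \<Rightarrow> vfield \<Rightarrow> real" where
  "local_quad (Triangle v) u w = measure lebesgue (region (Triangle v)) *
     (\<Sum>i\<in>UNIV. 1/3 * (u (tri_midpoint v i) \<bullet> w (tri_midpoint v i)))"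
| "local_quad (Rectangle a b) u w = measure lebesgue (region (Rectangle a b)) *
     ((\<Sum>i\<in>UNIV. 1/2 * (u (rect_midpoint a b (Hor i)) $ 1 * w (rect_midpoint a b (Hor i)) $ 1)) +
      (\<Sum>j\<in>UNIV. 1/2 * (u (rect_midpoint a b (Ver j)) $ 2 * w (rect_midpoint a b (Ver j)) $ 2)))"


definition lipschitz_domain :: "(real^2) set \<Rightarrow> bool" where
  "lipschitz_domain \<Omega> \<longleftrightarrow> open \<Omega> \<and> connected \<Omega> \<and> \<Omega> \<noteq> {} \<and>
     (\<forall>p \<in> frontier \<Omega>. \<exists>r > 0. \<exists>(Q :: real^2 \<Rightarrow> real^2) (g :: real \<Rightarrow> real) L.
        orthogonal_transformation Q \<and> L-lipschitz_on UNIV g \<and>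
        (\<forall>x \<in> ball p r. x \<in> \<Omega> \<longleftrightarrow> Q (x - p) $ 2 < g (Q (x - p) $ 1)))"

definition bounded_lipschitz_polygon :: "(real^2) set \<Rightarrow> bool" where
  "bounded_lipschitz_polygon \<Omega> \<longleftrightarrow> bounded \<Omega> \<and> lipschitz_domain \<Omega> \<and>
     (\<exists>S. finite S \<and> frontier \<Omega> = (\<Union>(p, q)\<in>S. closed_segment p q))"

definition mesh :: "(real^2) set \<Rightarrow> element set \<Rightarrow> bool" where
  "mesh \<Omega> T \<longleftrightarrow> finite T \<and> (\<forall>K\<in>T. valid_element K) \<and> (\<Union>K\<in>T. region K) = closure \<Omega> \<and>
     (\<forall>K\<in>T. \<forall>K'\<in>T. K \<noteq> K' \<longrightarrow>
        region K \<inter> region K' = {} \<or>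
        (\<exists>p \<in> vertices K \<inter> vertices K'. region K \<inter> region K' = {p}) \<or>
        (\<exists>e \<in> edges K \<inter> edges K'. region K \<inter> region K' = convex hull e))"

definition mesh_edges :: "element set \<Rightarrow> (real^2) set set" where
  "mesh_edges T = (\<Union>K\<in>T. edges K)"

definition edge_orientation ::
  "element set \<Rightarrow> ((real^2) set \<Rightarrow> (real^2) \<times> (real^2)) \<Rightarrow> bool" where
  "edge_orientation T ori \<longleftrightarrow> (\<forall>e \<in> mesh_edges T. endpoints (ori e) = e)"

text \<open>
  Piecewise polynomial fields are in general two-valued on edges. The polynomial \<open>u|\<^sub>K\<close> is
  recovered from the values of \<open>u\<close> in the interior of \<open>K\<close>; by continuity its values on \<open>K\<close>
  do not depend on the choice.
\<close>

definition restriction :: "element \<Rightarrow> vfield \<Rightarrow> vfield" where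
  "restriction K u = (SOME p. p \<in> local_space K \<and> (\<forall>x \<in> interior (region K). u x = p x))"

definition global_quad :: "element set \<Rightarrow> vfield \<Rightarrow> vfield \<Rightarrow> real" where
  "global_quad T u w = (\<Sum>K\<in>T. local_quad K (restriction K u) (restriction K w))"

text \<open>
  The arguments \<open>\<alpha>\<close>, \<open>\<beta>\<close>, \<open>\<gamma>\<close> below assign to every triangle its own parameters.
\<close>

primrec local_edge_fun ::
  "(real^2^3 \<Rightarrow> 3 \<Rightarrow> real) \<Rightarrow> (real^2^3 \<Rightarrow> 3 \<Rightarrow> real) \<Rightarrow> (real^2^3 \<Rightarrow> 3 \<Rightarrow> real) \<Rightarrow>
   (real^2) set \<Rightarrow> element \<Rightarrow> vfield" where
  "local_edge_fun \<alpha> \<beta> \<gamma> e (Triangle v) =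
     tri_edge_fun v (\<alpha> v) (\<beta> v) (\<gamma> v) (THE i. endpoints (tri_edge v i) = e)"
| "local_edge_fun \<alpha> \<beta> \<gamma> e (Rectangle a b) =
     rect_basis a b (THE d. endpoints (rect_edge a b d) = e)"

definition edge_sign :: "(real^2) \<times> (real^2) \<Rightarrow> vfield \<Rightarrow> real" where
  "edge_sign pq F =
     (THE s. s \<in> {1, -1} \<and> tangential_integral pq (\<lambda>x. s *\<^sub>R F x) = 1)"

definition zero_ext :: "element \<Rightarrow> vfield \<Rightarrow> vfield" where
  "zero_ext K F x = (if x \<in> interior (region K) then F x else 0)"

datatype dof = Edge_Dof "(real^2) set" | Bubble_Dof "real^2^3" 3

definition dofs :: "element set \<Rightarrow> dof set" where
  "dofs T = Edge_Dof ` mesh_edges T \<union> {Bubble_Dof v i | v i. Triangle v \<in> T}"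

primrec global_basis ::
  "element set \<Rightarrow> (real^2^3 \<Rightarrow> 3 \<Rightarrow> real) \<Rightarrow> (real^2^3 \<Rightarrow> 3 \<Rightarrow> real) \<Rightarrow> (real^2^3 \<Rightarrow> 3 \<Rightarrow> real) \<Rightarrow>
   ((real^2) set \<Rightarrow> (real^2) \<times> (real^2)) \<Rightarrow> dof \<Rightarrow> vfield" where
  "global_basis T \<alpha> \<beta> \<gamma> ori (Edge_Dof e) =
     (\<lambda>x. \<Sum>K \<in> {K \<in> T. e \<in> edges K}.
        zero_ext K (\<lambda>y. edge_sign (ori e) (local_edge_fun \<alpha> \<beta> \<gamma> e K) *\<^sub>R
                        local_edge_fun \<alpha> \<beta> \<gamma> e K y) x)"
| "global_basis T \<alpha> \<beta> \<gamma> ori (Bubble_Dof v i) = zero_ext (Triangle v) (tri_bubble v i)"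

end

theory Submission
  imports Defs
begin

text \<open>
  At the midpoint \<open>m\<^sub>l\<close> of the edge opposite vertex \<open>l\<close> the barycentric coordinates are \<open>0, 1/2, 1/2\<close>,
  so exactly one bubble survives there, with value \<open>1/4 \<nabla>\<lambda>\<^sub>l\<close>, which is normal to the edge. Hence each
  of the nine normal components of the edge functions at the midpoints is corrected to zero by
  exactly one parameter. Once this is done, edge functions are tangential and bubbles are normal at
  every midpoint, and an edge function also has zero tangential component at the midpoints of the
  other two edges, so it vanishes there: no two basis functions interact at a quadrature point. On a
  rectangle the horizontal and vertical functions are seen by different quadrature points, and each
  vanishes on the opposite edge.

  For a mesh, the elements have pairwise disjoint interiors, and by continuity the polynomial on an
  element is determined at the quadrature points by its values in the interior. Each term of the
  global quadrature is therefore a multiple of an off-diagonal local entry.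
\<close>

section \<open>Triangles\<close>

lemma inner_vec2: "x \<bullet> y = x$1 * y$1 + x$2 * y$2" for x y :: "real^2"
  by (simp add: inner_vec_def sum_2)

lemma vec2_eq_iff: "x = y \<longleftrightarrow> x$1 = y$1 \<and> x$2 = y$2" for x y :: "'a^2"
  by (simp add: vec_eq_iff forall_2)

text \<open>Splitting by the offset from a given index, instead of by numerals, keeps all later case
  distinctions cyclically symmetric.\<close>

lemma cyclic_cases:
  fixes l i :: 3
  obtains "l = i" | "l = i + 1" | "l = i + 2"
  using exhaust_3[of i] exhaust_3[of l] by fastforce

text \<open>Brings every offset to one of \<open>i\<close>, \<open>i + 1\<close>,
  \<open>i + 2\<close>; the rules for 3 and 4 catch offsets whose numerals have already been added
  up.\<close>

lemma cyclic_simps [simp]: "i + 1 + 1 = i + 2" "i + 1 + 2 = i" "i + 2 + 1 = i" "i + 2 + 2 = i + 1"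
  "i + 1 \<noteq> i" "i + 2 \<noteq> i" "i + 1 \<noteq> i + 2" "i + 2 \<noteq> i + 1" "i \<noteq> i + 1" "i \<noteq> i + 2"
  "i + 3 = i" "i + 4 = i + 1"
  for i :: 3
  using exhaust_3[of i] by auto

lemma three_reduce [simp]: "(4::3) = 1" "(5::3) = 2"
  by simp_all

lemma sum_cyclic: "sum f UNIV = f i + f (i + 1) + f (i + 2)" for i :: 3
  and f :: "3 \<Rightarrow> 'a::comm_monoid_add"
proof -
  have "UNIV = {i, i + 1, i + 2}" by (auto intro: cyclic_cases)
  then have "sum f UNIV = sum f {i, i + 1, i + 2}" by (rule arg_cong)
  also have "\<dots> = f i + f (i + 1) + f (i + 2)" by (simp add: add.assoc)
  finally show ?thesis .
qed

section \<open>Closed forms of the barycentric coordinates and their gradients\<close>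

definition tri_det :: "real^2^3 \<Rightarrow> real" where
  "tri_det v = (v$2$1 - v$1$1) * (v$3$2 - v$1$2) - (v$2$2 - v$1$2) * (v$3$1 - v$1$1)"

text \<open>Twice the signed area is invariant under cyclic renumbering, so a computation based at
  one vertex serves all three.\<close>

lemma tri_det_cyclic:
  "tri_det v = (v$(i+1)$1 - v$i$1) * (v$(i+2)$2 - v$i$2) - (v$(i+1)$2 - v$i$2) * (v$(i+2)$1 - v$i$1)"
  using exhaust_3[of i] by (auto simp: tri_det_def algebra_simps)

lemma range_vec3: "range (($) v) = {v$1, v$2, v$3}" for v :: "'a^3"
  by (auto simp: UNIV_3)

lemma collinear_2D:
  fixes x y :: "real^2"
  assumes "x$1 * y$2 = x$2 * y$1"
  shows "collinear {0, x, y}"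
proof (cases "x = 0")
  case False
  then have nz: "x$1 \<noteq> 0 \<or> x$2 \<noteq> 0" by (simp add: vec2_eq_iff)
  have "\<exists>c. y = c *\<^sub>R x"
  proof (cases "x$1 = 0")
    case True
    with nz assms show ?thesis
      by (intro exI[of _ "y$2 / x$2"]) (auto simp: vec2_eq_iff field_simps)
  next
    case False
    with assms show ?thesis
      by (intro exI[of _ "y$1 / x$1"]) (auto simp: vec2_eq_iff field_simps)
  qed
  then show ?thesis by (simp add: collinear_lemma)
qed (simp add: collinear_lemma)

lemma tri_det_nonzero:
  assumes "nondegenerate v"
  shows "tri_det v \<noteq> 0"
proof
  assume "tri_det v = 0"
  then have "collinear {0, v$2 - v$1, v$3 - v$1}"
    by (intro collinear_2D) (simp add: tri_det_def)
  then have "collinear {v$2, v$1, v$3}"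
    by (simp add: collinear_3[of "v$2" "v$1" "v$3"])
  then show False
    using assms by (simp add: nondegenerate_def range_vec3 insert_commute)
qed

text \<open>The edge opposite vertex \<open>i\<close>, turned by a right angle and divided by twice
  the signed area.\<close>

definition bary_grad :: "real^2^3 \<Rightarrow> 3 \<Rightarrow> real^2" where
  "bary_grad v i = vector [(v$(i+1)$2 - v$(i+2)$2) / tri_det v, (v$(i+2)$1 - v$(i+1)$1) / tri_det v]"

lemma bary_grad_orthogonal_edge: "bary_grad v i \<bullet> (v$(i+2) - v$(i+1)) = 0"
  by (simp add: bary_grad_def inner_vec2 divide_simps) (simp add: algebra_simps)

text \<open>The turned opposite edge paired with this side is \<open>tri_det v\<close> in its form
  based at \<open>i\<close>.\<close>

lemma bary_grad_inner_vertex: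
  assumes "nondegenerate v"
  shows "bary_grad v i \<bullet> (v$i - v$(i+1)) = 1"
  using tri_det_nonzero[OF assms] tri_det_cyclic[of v i]
  by (simp add: bary_grad_def inner_vec2 divide_simps) (simp add: algebra_simps)

text \<open>The barycentric coordinate is the affine function with gradient
  \<open>bary_grad v i\<close> that vanishes at one end of the opposite edge. To evaluate the
  definite description, these values are shown to solve the system and every solution is shown to
  have these components.\<close>

lemma bary_eq:
  assumes "nondegenerate v"
  shows "bary v i x = bary_grad v i \<bullet> (x - v$(i+1))"
proof -
  let ?P = "\<lambda>l :: real^3. (\<Sum>j\<in>UNIV. l$j) = 1 \<and> (\<Sum>j\<in>UNIV. l$j *\<^sub>R v$j) = x"
  define l :: "real^3" where "l = (\<chi> i. bary_grad v i \<bullet> (x - v$(i+1)))"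
  have "?P l"
    using tri_det_nonzero[OF assms]
    by (simp add: l_def sum_3 bary_grad_def inner_vec2 vec2_eq_iff divide_simps)
      (simp add: tri_det_def algebra_simps)
  moreover have "m = l" if "?P m" for m
  proof -
    have "m$i = l$i" for i
    proof -
      have s: "m$i + m$(i+1) + m$(i+2) = 1"
        and x: "m$i *\<^sub>R v$i + m$(i+1) *\<^sub>R v$(i+1) + m$(i+2) *\<^sub>R v$(i+2) = x"
        using that by (simp_all add: sum_cyclic[of _ i])
      \<comment> \<open>Inserting the weight sum 1 turns the offset into a combination of two edge
        vectors. Pairing with \<open>bary_grad v i\<close> kills one of them and gives 1 on the
        other, which isolates \<open>m$i\<close>.\<close>
      have "x - v$(i+1) = x - (m$i + m$(i+1) + m$(i+2)) *\<^sub>R v$(i+1)" using s by simp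
      also have "\<dots> = m$i *\<^sub>R (v$i - v$(i+1)) + m$(i+2) *\<^sub>R (v$(i+2) - v$(i+1))"
        by (subst x[symmetric]) (simp add: algebra_simps)
      finally show ?thesis
        by (simp add: l_def inner_add_right bary_grad_inner_vertex[OF assms] bary_grad_orthogonal_edge)
    qed
    then show ?thesis by (simp add: vec_eq_iff)
  qed
  ultimately have "(THE l. ?P l) = l" by (rule the_equality)
  then show ?thesis by (simp add: bary_def l_def)
qed

text \<open>The definite description in \<open>grad\<close> requires uniqueness: derivatives are
  unique, and a functional determines the vector that represents it.\<close>

lemma grad_bary:
  assumes "nondegenerate v"
  shows "grad (bary v i) x = bary_grad v i"
proof -
  have "bary v i = (\<lambda>x. bary_grad v i \<bullet> (x - v$(i+1)))"
    using bary_eq[OF assms] by blast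
  then have D: "GDERIV (bary v i) x :> bary_grad v i"
    by (auto simp: gderiv_def inner_commute intro!: derivative_eq_intros)
  have "D = bary_grad v i" if "GDERIV (bary v i) x :> D" for D
  proof -
    have "(\<lambda>h. h \<bullet> D) = (\<lambda>h. h \<bullet> bary_grad v i)"
      using has_derivative_unique that D unfolding gderiv_def by blast
    then show ?thesis using vector_eq_ldot[of D "bary_grad v i"] by (simp add: fun_eq_iff)
  qed
  with D show ?thesis unfolding grad_def by (rule the_equality)
qed

section \<open>Values at the edge midpoints\<close>

lemma bary_midpoint:
  assumes "nondegenerate v"
  shows "bary v i (tri_midpoint v l) = (if i = l then 0 else 1/2)"
proof (cases i l rule: cyclic_cases)
  case 1
  \<comment> \<open>In each case the offset from the base point of the closed form is expressed by
    edge vectors on which the gradient takes the value 0 or 1.\<close>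
  have "tri_midpoint v l - v$(l+1) = (1/2) *\<^sub>R (v$(l+2) - v$(l+1))"
    by (simp add: tri_midpoint_def midpoint_def vec2_eq_iff field_simps)
  with 1 show ?thesis
    by (simp add: bary_eq[OF assms] bary_grad_orthogonal_edge)
next
  case 2
  have "tri_midpoint v l - v$(l+2) = (1/2) *\<^sub>R (v$(l+1) - v$(l+2))"
    by (simp add: tri_midpoint_def midpoint_def vec2_eq_iff field_simps)
  with 2 show ?thesis
    using bary_grad_inner_vertex[OF assms, of "l+1"] by (simp add: bary_eq[OF assms])
next
  case 3
  have "tri_midpoint v l - v$l = (1/2) *\<^sub>R (v$(l+2) - v$l) + (1/2) *\<^sub>R (v$(l+1) - v$l)"
    by (simp add: tri_midpoint_def midpoint_def vec2_eq_iff field_simps)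
  with 3 show ?thesis
    using bary_grad_inner_vertex[OF assms, of "l+2"] bary_grad_orthogonal_edge[of v "l+2"]
    by (simp add: bary_eq[OF assms] inner_add_right)
qed

text \<open>Neither of the two coordinates in the bubble vanishes at the midpoint only if
  \<open>l\<close> is the remaining index \<open>i + 2\<close>; their product is then 1/4.\<close>

lemma tri_bubble_midpoint:
  assumes "nondegenerate v"
  shows "tri_bubble v i (tri_midpoint v l) = (if l = i + 2 then (1/4) *\<^sub>R bary_grad v l else 0)"
  by (cases l i rule: cyclic_cases)
    (simp_all add: tri_bubble_def grad_bary[OF assms] bary_midpoint[OF assms])

text \<open>For \<open>l = i\<close> or \<open>l = i + 1\<close> the coordinate of vertex
  \<open>l\<close> vanishes at the midpoint, so what is left of the Whitney part is a multiple of
  \<open>bary_grad v l\<close>. That vector is normal to the edge, and so is every bubble value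
  there.\<close>

lemma tri_edge_fun_tangential_midpoint:
  assumes "nondegenerate v" "l \<noteq> i + 2"
  shows "tri_edge_fun v \<alpha> \<beta> \<gamma> i (tri_midpoint v l) \<bullet> (v$(l+2) - v$(l+1)) = 0"
  using assms(2)
  by (cases l i rule: cyclic_cases)
    (use bary_grad_orthogonal_edge[of v i] bary_grad_orthogonal_edge[of v "i+1"]
     in \<open>simp_all add: tri_edge_fun_def grad_bary[OF assms(1)] tri_bubble_midpoint[OF assms(1)]
          bary_midpoint[OF assms(1)] inner_add_left inner_diff_left\<close>)

section \<open>Edge normals and the choice of the parameters\<close>

lemma orthogonal_2D_collinear:
  fixes n t g :: "real^2"
  assumes "t \<noteq> 0" "g \<noteq> 0" "g \<bullet> t = 0" "n \<bullet> t = 0"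
  obtains c where "n = c *\<^sub>R g"
proof -
  have nz: "t$1 \<noteq> 0 \<or> t$2 \<noteq> 0" using assms(1) by (simp add: vec2_eq_iff)
  have e: "g$1 * t$1 = - (g$2 * t$2)" "n$1 * t$1 = - (n$2 * t$2)"
    using assms(3,4) by (simp_all add: inner_vec2)
  \<comment> \<open>The determinant of \<open>n\<close> and \<open>g\<close> is annihilated by both
    components of \<open>t\<close>, one of which is nonzero. The factor found below is that of the
    orthogonal projection onto \<open>g\<close>.\<close>
  have "t$1 * (n$1 * g$2 - n$2 * g$1) = 0" "t$2 * (n$1 * g$2 - n$2 * g$1) = 0"
    using e by algebra+
  with nz have "n$1 * g$2 = n$2 * g$1" by auto
  moreover have "g \<bullet> g \<noteq> 0" using assms(2) by simp
  ultimately have "n = ((n \<bullet> g) / (g \<bullet> g)) *\<^sub>R g"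
    by (simp add: vec2_eq_iff inner_vec2 field_simps)
  then show ?thesis by (rule that)
qed

lemma tri_edge_nonzero:
  assumes "nondegenerate v"
  shows "v$(l+2) - v$(l+1) \<noteq> 0"
  using bary_grad_inner_vertex[OF assms, of "l+1"] by auto

lemma bary_grad_nonzero:
  assumes "nondegenerate v"
  shows "bary_grad v l \<noteq> 0"
  using bary_grad_inner_vertex[OF assms, of l] by auto

text \<open>All unit normals of an edge are multiples of \<open>bary_grad v l\<close>, so testing
  with this single unnormalised normal is equivalent.\<close>

lemma normal_components_vanish_iff:
  assumes "nondegenerate v"
  shows "normal_components_vanish v \<alpha> \<beta> \<gamma> \<longleftrightarrow>
    (\<forall>i l. tri_edge_fun v \<alpha> \<beta> \<gamma> i (tri_midpoint v l) \<bullet> bary_grad v l = 0)"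
proof (intro iffI allI)
  fix i l
  let ?n = "(1 / norm (bary_grad v l)) *\<^sub>R bary_grad v l"
  assume "normal_components_vanish v \<alpha> \<beta> \<gamma>"
  moreover have "norm ?n = 1" "?n \<bullet> (v$(l+2) - v$(l+1)) = 0"
    using bary_grad_nonzero[OF assms] bary_grad_orthogonal_edge by simp_all
  ultimately have "tri_edge_fun v \<alpha> \<beta> \<gamma> i (tri_midpoint v l) \<bullet> ?n = 0"
    unfolding normal_components_vanish_def by blast
  then show "tri_edge_fun v \<alpha> \<beta> \<gamma> i (tri_midpoint v l) \<bullet> bary_grad v l = 0"
    using bary_grad_nonzero[OF assms] by simp
next
  assume *: "\<forall>i l. tri_edge_fun v \<alpha> \<beta> \<gamma> i (tri_midpoint v l) \<bullet> bary_grad v l = 0"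
  show "normal_components_vanish v \<alpha> \<beta> \<gamma>"
    unfolding normal_components_vanish_def
  proof (intro allI impI)
    fix i l n
    assume "norm n = 1 \<and> n \<bullet> (v$(l+2) - v$(l+1)) = 0"
    then have "n \<bullet> (v$(l+2) - v$(l+1)) = 0" ..
    then obtain c where "n = c *\<^sub>R bary_grad v l"
      by (rule orthogonal_2D_collinear[OF tri_edge_nonzero[OF assms] bary_grad_nonzero[OF assms]
            bary_grad_orthogonal_edge])
    then show "tri_edge_fun v \<alpha> \<beta> \<gamma> i (tri_midpoint v l) \<bullet> n = 0"
      using * by simp
  qed
qed

lemma normal_components_vanish_exists:
  assumes "nondegenerate v"
  shows "\<exists>\<alpha> \<beta> \<gamma>. normal_components_vanish v \<alpha> \<beta> \<gamma>"
proof -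
  define w where "w i l = tri_edge_fun v (\<lambda>_. 0) (\<lambda>_. 0) (\<lambda>_. 0) i (tri_midpoint v l)" for i l
  \<comment> \<open>The surviving bubble has value 1/4 of the gradient, hence the factor 4: this
    multiple cancels the normal component of the uncorrected function \<open>w i l\<close>.\<close>
  define c where "c i l = - 4 * (w i l \<bullet> bary_grad v l) / (bary_grad v l \<bullet> bary_grad v l)" for i l
  \<comment> \<open>The bubble with number \<open>j\<close> survives at midpoint
    \<open>j + 2\<close>. So \<alpha>, \<beta>, \<gamma>, which multiply bubbles \<open>i\<close>,
    \<open>i + 1\<close>, \<open>i + 2\<close>, correct midpoints \<open>i + 2\<close>,
    \<open>i\<close>, \<open>i + 1\<close> respectively.\<close>
  let ?E = "tri_edge_fun v (\<lambda>i. c i (i+2)) (\<lambda>i. c i i) (\<lambda>i. c i (i+1))"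
  have "?E i (tri_midpoint v l) = w i l + (c i l / 4) *\<^sub>R bary_grad v l" for i l
    by (cases l i rule: cyclic_cases)
      (simp_all add: w_def tri_edge_fun_def tri_bubble_midpoint[OF assms])
  moreover have "c i l / 4 * (bary_grad v l \<bullet> bary_grad v l) = - (w i l \<bullet> bary_grad v l)" for i l
    using bary_grad_nonzero[OF assms] by (simp add: c_def)
  ultimately have "?E i (tri_midpoint v l) \<bullet> bary_grad v l = 0" for i l
    by (simp add: inner_add_left)
  then show ?thesis using normal_components_vanish_iff[OF assms] by blast
qed

text \<open>Orthogonality to the edge makes the value a multiple of \<open>bary_grad v l\<close>;
  the vanishing normal component forces that multiple to be zero.\<close>

lemma tri_edge_fun_midpoint_eq_0:
  assumes "nondegenerate v" "normal_components_vanish v \<alpha> \<beta> \<gamma>" "l \<noteq> i + 2"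
  shows "tri_edge_fun v \<alpha> \<beta> \<gamma> i (tri_midpoint v l) = 0"
proof -
  let ?w = "tri_edge_fun v \<alpha> \<beta> \<gamma> i (tri_midpoint v l)"
  obtain c where c: "?w = c *\<^sub>R bary_grad v l"
    by (rule orthogonal_2D_collinear[OF tri_edge_nonzero[OF assms(1)] bary_grad_nonzero[OF assms(1)]
          bary_grad_orthogonal_edge tri_edge_fun_tangential_midpoint[OF assms(1,3)]])
  moreover have "?w \<bullet> bary_grad v l = 0"
    using assms(2) normal_components_vanish_iff[OF assms(1)] by blast
  ultimately show ?thesis using bary_grad_nonzero[OF assms(1)] by auto
qed

text \<open>Each summand of the quadrature vanishes separately.\<close>

lemma tri_mass_matrix_diagonal:
  assumes "nondegenerate v" "normal_components_vanish v \<alpha> \<beta> \<gamma>"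
  shows "diagonal_on UNIV (gram (local_quad (Triangle v)) (tri_basis v \<alpha> \<beta> \<gamma>))"
proof -
  have "tri_basis v \<alpha> \<beta> \<gamma> p (tri_midpoint v l) \<bullet> tri_basis v \<alpha> \<beta> \<gamma> q (tri_midpoint v l) = 0"
    if "p \<noteq> q" for p q l
  proof -
    have E: "tri_edge_fun v \<alpha> \<beta> \<gamma> i (tri_midpoint v l) = 0" if "l \<noteq> i + 2" for i
      by (rule tri_edge_fun_midpoint_eq_0[OF assms that])
    have N: "tri_edge_fun v \<alpha> \<beta> \<gamma> i (tri_midpoint v l) \<bullet> bary_grad v l = 0" for i l
      using assms(2) normal_components_vanish_iff[OF assms(1)] by blast
    \<comment> \<open>Only one \<open>i\<close> satisfies \<open>l = i + 2\<close>, so at least one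
      of the two factors is zero.\<close>
    have EE: "tri_edge_fun v \<alpha> \<beta> \<gamma> i (tri_midpoint v l) \<bullet> tri_edge_fun v \<alpha> \<beta> \<gamma> j (tri_midpoint v l) = 0"
      if "i \<noteq> j" for i j
      using that E[of i] E[of j] by (cases "l = i + 2") auto
    have N': "bary_grad v l \<bullet> tri_edge_fun v \<alpha> \<beta> \<gamma> i (tri_midpoint v l) = 0" for i l
      using N by (simp add: inner_commute)
    \<comment> \<open>An edge function against a bubble yields its normal component; two different
      bubbles are never both nonzero at the same midpoint.\<close>
    from that show ?thesis
      by (cases p; cases q) (simp_all add: tri_bubble_midpoint[OF assms(1)] N N' EE)
  qed
  then show ?thesis by (simp add: diagonal_on_def gram_def)
qed


section \<open>Rectangles\<close>

text \<open>The first component depends on \<open>x$2\<close> alone, so the integrand is constant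
  along a horizontal segment; the second component is perpendicular to it.\<close>

lemma tangential_integral_horizontal:
  assumes "\<And>x. u x = vector [p + q * x$2, r x]"
  shows "tangential_integral (vector [s, y], vector [t, y]) u = (p + q * y) * (t - s)"
proof -
  have "u (linepath (vector [s, y]) (vector [t, y]) z) \<bullet> (vector [t, y] - vector [s, y])
      = (p + q * y) * (t - s)" for z
    by (simp add: assms inner_vec2 linepath_def algebra_simps)
  then show ?thesis by (simp add: tangential_integral_def)
qed

lemma tangential_integral_vertical:
  assumes "\<And>x. u x = vector [r x, p + q * x$1]"
  shows "tangential_integral (vector [y, s], vector [y, t]) u = (p + q * y) * (t - s)"
proof -
  have "u (linepath (vector [y, s]) (vector [y, t]) z) \<bullet> (vector [y, t] - vector [y, s])
      = (p + q * y) * (t - s)" for z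
    by (simp add: assms inner_vec2 linepath_def algebra_simps)
  then show ?thesis by (simp add: tangential_integral_def)
qed

text \<open>Justifies the definite description in \<open>rect_basis\<close>. Here \<open>y\<close>
  is the height of the edge and \<open>z\<close> that of the opposite edge: vanishing at height
  \<open>z\<close> makes the first component a multiple of \<open>x$2 - z\<close>, and the
  tangential integral fixes the factor.\<close>

lemma horizontal_basis_unique:
  assumes "s \<noteq> t" "y \<noteq> z"
  shows "\<exists>!\<Phi>. \<Phi> \<in> N0_rect \<and> (\<forall>x. \<Phi> x $ 2 = 0) \<and>
    tangential_integral (vector [s, y], vector [t, y]) \<Phi> = 1 \<and>
    (\<forall>x \<in> closed_segment (vector [s, z]) (vector [t, z]). \<Phi> x = 0)"
    (is "\<exists>!\<Phi>. ?P \<Phi>")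
proof (rule ex1I)
  define q where "q = 1 / ((y - z) * (t - s))"
  \<comment> \<open>The null terms keep the literal shape of members of \<open>N0_rect\<close>, so
    that membership is a matter of matching.\<close>
  define \<Psi> :: vfield where "\<Psi> = (\<lambda>x. vector [- (q * z) + q * x$2, 0 + 0 * x$1])"
  have \<Psi>: "\<Psi> x = vector [- (q * z) + q * x$2, 0 + 0 * x$1]" for x by (simp add: \<Psi>_def)
  have q: "q * ((y - z) * (t - s)) = 1" using assms by (simp add: q_def)
  show "?P \<Psi>"
  proof (intro conjI allI ballI)
    show "\<Psi> \<in> N0_rect" unfolding N0_rect_def \<Psi>_def by blast
    show "\<Psi> x $ 2 = 0" for x by (simp add: \<Psi>_def)
    show "tangential_integral (vector [s, y], vector [t, y]) \<Psi> = 1"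
      using q by (simp add: tangential_integral_horizontal[of \<Psi>, OF \<Psi>] algebra_simps)
    show "\<Psi> x = 0" if "x \<in> closed_segment (vector [s, z]) (vector [t, z])" for x
      using that by (auto simp: \<Psi>_def closed_segment_def vec2_eq_iff algebra_simps)
  qed
  fix \<Phi> assume P: "?P \<Phi>"
  then obtain a b c d where \<Phi>: "\<And>x. \<Phi> x = vector [a + b * x$2, c + d * x$1]"
    unfolding N0_rect_def by blast
  have 1: "(a + b * y) * (t - s) = 1"
    using P tangential_integral_horizontal[of \<Phi> a b, OF \<Phi>] by simp
  \<comment> \<open>One endpoint of the opposite edge already determines \<open>a\<close> from
    \<open>b\<close>.\<close>
  have "\<Phi> (vector [s, z]) = 0" using P by blast
  then have 2: "a = - (b * z)" by (simp add: \<Phi> vec2_eq_iff)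
  have "b * ((y - z) * (t - s)) = q * ((y - z) * (t - s))" using 1 q by (simp add: 2 algebra_simps)
  then have "b = q" using assms by simp
  with P 2 show "\<Phi> = \<Psi>" by (auto simp: fun_eq_iff \<Psi>_def vec2_eq_iff \<Phi>)
qed

text \<open>The same argument with the coordinates exchanged; \<open>a\<close> and \<open>b\<close>
  now name the coefficients of the second component.\<close>

lemma vertical_basis_unique:
  assumes "s \<noteq> t" "y \<noteq> z"
  shows "\<exists>!\<Phi>. \<Phi> \<in> N0_rect \<and> (\<forall>x. \<Phi> x $ 1 = 0) \<and>
    tangential_integral (vector [y, s], vector [y, t]) \<Phi> = 1 \<and>
    (\<forall>x \<in> closed_segment (vector [z, s]) (vector [z, t]). \<Phi> x = 0)"
    (is "\<exists>!\<Phi>. ?P \<Phi>")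
proof (rule ex1I)
  define q where "q = 1 / ((y - z) * (t - s))"
  define \<Psi> :: vfield where "\<Psi> = (\<lambda>x. vector [0 + 0 * x$2, - (q * z) + q * x$1])"
  have \<Psi>: "\<Psi> x = vector [0 + 0 * x$2, - (q * z) + q * x$1]" for x by (simp add: \<Psi>_def)
  have q: "q * ((y - z) * (t - s)) = 1" using assms by (simp add: q_def)
  show "?P \<Psi>"
  proof (intro conjI allI ballI)
    show "\<Psi> \<in> N0_rect" unfolding N0_rect_def \<Psi>_def by blast
    show "\<Psi> x $ 1 = 0" for x by (simp add: \<Psi>_def)
    show "tangential_integral (vector [y, s], vector [y, t]) \<Psi> = 1"
      using q by (simp add: tangential_integral_vertical[of \<Psi>, OF \<Psi>] algebra_simps)
    show "\<Psi> x = 0" if "x \<in> closed_segment (vector [z, s]) (vector [z, t])" for x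
      using that by (auto simp: \<Psi>_def closed_segment_def vec2_eq_iff algebra_simps)
  qed
  fix \<Phi> assume P: "?P \<Phi>"
  then obtain a b c d where \<Phi>: "\<And>x. \<Phi> x = vector [c + d * x$2, a + b * x$1]"
    unfolding N0_rect_def by blast
  have 1: "(a + b * y) * (t - s) = 1"
    using P tangential_integral_vertical[of \<Phi> _ a b, OF \<Phi>] by simp
  have "\<Phi> (vector [z, s]) = 0" using P by blast
  then have 2: "a = - (b * z)" by (simp add: \<Phi> vec2_eq_iff)
  have "b * ((y - z) * (t - s)) = q * ((y - z) * (t - s))" using 1 q by (simp add: 2 algebra_simps)
  then have "b = q" using assms by simp
  with P 2 show "\<Phi> = \<Psi>" by (auto simp: fun_eq_iff \<Psi>_def vec2_eq_iff \<Phi>)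
qed

lemma two_opposite_eq_1: "i + 1 = 1 \<longleftrightarrow> i \<noteq> 1" for i :: 2
  using exhaust_2[of i] by auto

lemma rect_basis_Hor:
  assumes "proper_rect a b"
  shows "rect_basis a b (Hor i) \<in> N0_rect"
    and "rect_basis a b (Hor i) x $ 2 = 0"
    and "j \<noteq> i \<Longrightarrow> rect_basis a b (Hor i) (rect_midpoint a b (Hor j)) = 0"
proof -
  \<comment> \<open>Coordinates of edge \<open>i\<close> and of its opposite edge, left as
    conditionals so that the uniqueness lemma matches the unfolded definition for both values of
    \<open>i\<close>.\<close>
  let ?y = "if i = 1 then a$2 else b$2" and ?z = "if i + 1 = 1 then a$2 else b$2"
  have "a$1 \<noteq> b$1" "?y \<noteq> ?z"
    using assms by (simp_all only: two_opposite_eq_1) (simp_all add: proper_rect_def)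
  note P = theI'[OF horizontal_basis_unique[OF this],
      folded rect_basis.simps(1)[of a b i, unfolded rect_edge.simps Let_def fst_conv snd_conv]]
  show "rect_basis a b (Hor i) \<in> N0_rect" "rect_basis a b (Hor i) x $ 2 = 0"
    using P by blast+
  show "rect_basis a b (Hor i) (rect_midpoint a b (Hor j)) = 0" if "j \<noteq> i"
  proof -
    \<comment> \<open>The other index is that of the opposite edge, whose midpoint lies on the
      segment where the function vanishes.\<close>
    have "j = i + 1" using that exhaust_2[of i] exhaust_2[of j] by auto
    then show ?thesis using P by (simp add: rect_midpoint_def Let_def del: rect_basis.simps)
  qed
qed

lemma rect_basis_Ver:
  assumes "proper_rect a b"
  shows "rect_basis a b (Ver i) \<in> N0_rect"
    and "rect_basis a b (Ver i) x $ 1 = 0"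
    and "j \<noteq> i \<Longrightarrow> rect_basis a b (Ver i) (rect_midpoint a b (Ver j)) = 0"
proof -
  let ?y = "if i = 1 then a$1 else b$1" and ?z = "if i + 1 = 1 then a$1 else b$1"
  have "a$2 \<noteq> b$2" "?y \<noteq> ?z"
    using assms by (simp_all only: two_opposite_eq_1) (simp_all add: proper_rect_def)
  note P = theI'[OF vertical_basis_unique[OF this],
      folded rect_basis.simps(2)[of a b i, unfolded rect_edge.simps Let_def fst_conv snd_conv]]
  show "rect_basis a b (Ver i) \<in> N0_rect" "rect_basis a b (Ver i) x $ 1 = 0"
    using P by blast+
  show "rect_basis a b (Ver i) (rect_midpoint a b (Ver j)) = 0" if "j \<noteq> i"
  proof -
    have "j = i + 1" using that exhaust_2[of i] exhaust_2[of j] by auto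
    then show ?thesis using P by (simp add: rect_midpoint_def Let_def del: rect_basis.simps)
  qed
qed

lemma rect_basis_in_N0_rect:
  assumes "proper_rect a b"
  shows "rect_basis a b d \<in> N0_rect"
  using rect_basis_Hor(1)[OF assms] rect_basis_Ver(1)[OF assms] by (cases d) blast+

text \<open>Functions of different orientation have no common nonzero component. Of two functions
  with the same orientation, one vanishes at each midpoint of that orientation, and at the other
  midpoints the tested component is zero.\<close>

lemma rect_mass_matrix_diagonal:
  assumes "proper_rect a b"
  shows "diagonal_on UNIV (gram (local_quad (Rectangle a b)) (rect_basis a b))"
proof -
  let ?f = "\<lambda>d x. rect_basis a b d x"
  have "?f p (rect_midpoint a b (Hor i)) $ 1 * ?f q (rect_midpoint a b (Hor i)) $ 1 = 0 \<and>
        ?f p (rect_midpoint a b (Ver i)) $ 2 * ?f q (rect_midpoint a b (Ver i)) $ 2 = 0"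
    if "p \<noteq> q" for p q i
  proof -
    have H: "?f (Hor j) (rect_midpoint a b (Hor i)) $ 1 = 0" if "j \<noteq> i" for j
      using rect_basis_Hor(3)[OF assms] that by (metis zero_index)
    have V: "?f (Ver j) (rect_midpoint a b (Ver i)) $ 2 = 0" if "j \<noteq> i" for j
      using rect_basis_Ver(3)[OF assms] that by (metis zero_index)
    from that show ?thesis
      using H V rect_basis_Hor(2)[OF assms] rect_basis_Ver(2)[OF assms]
      by (cases p; cases q) (simp_all del: rect_basis.simps, metis+)
  qed
  note products = this
  have "local_quad (Rectangle a b) (?f p) (?f q) = 0" if "p \<noteq> q" for p q
    unfolding local_quad.simps
    by (simp only: products[OF that, THEN conjunct1] products[OF that, THEN conjunct2]
        mult_zero_right sum.neutral_const add_0_right)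
  then show ?thesis unfolding diagonal_on_def gram_def by blast
qed


section \<open>Recovering element polynomials from interior values\<close>

lemma N0_triI: "(\<And>x. u x = vector [a - b * x$2, c + b * x$1]) \<Longrightarrow> u \<in> N0_tri"
  unfolding N0_tri_def by blast

lemma N0_rectI: "(\<And>x. u x = vector [a + b * x$2, c + d * x$1]) \<Longrightarrow> u \<in> N0_rect"
  unfolding N0_rect_def by blast

lemma N0_plusI:
  assumes "w \<in> N0_tri" "\<And>x. u x = w x + (\<Sum>i\<in>UNIV. c i *\<^sub>R tri_bubble v i x)"
  shows "u \<in> N0_plus v"
proof -
  have "u = (\<lambda>x. w x + (\<Sum>i\<in>UNIV. c i *\<^sub>R tri_bubble v i x))" using assms(2) by (rule ext)
  with assms(1) show ?thesis unfolding N0_plus_def by auto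
qed

lemma N0_tri_scaleR:
  assumes "u \<in> N0_tri"
  shows "(\<lambda>x. s *\<^sub>R u x) \<in> N0_tri"
proof -
  obtain a b c where u: "\<And>x. u x = vector [a - b * x$2, c + b * x$1]"
    using assms unfolding N0_tri_def by blast
  show ?thesis
    by (rule N0_triI[of _ "s * a" "s * b" "s * c"]) (simp add: u vec2_eq_iff algebra_simps)
qed

lemma N0_plus_scaleR:
  assumes "u \<in> N0_plus v"
  shows "(\<lambda>x. s *\<^sub>R u x) \<in> N0_plus v"
proof -
  obtain w c where w: "w \<in> N0_tri" "u = (\<lambda>x. w x + (\<Sum>i\<in>UNIV. c i *\<^sub>R tri_bubble v i x))"
    using assms unfolding N0_plus_def by blast
  show ?thesis
    by (rule N0_plusI[OF N0_tri_scaleR[OF w(1), of s], of _ "\<lambda>i. s * c i"])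
      (simp add: w(2) scaleR_right_distrib scaleR_right.sum)
qed

lemma N0_rect_scaleR:
  assumes "u \<in> N0_rect"
  shows "(\<lambda>x. s *\<^sub>R u x) \<in> N0_rect"
proof -
  obtain a b c d where u: "\<And>x. u x = vector [a + b * x$2, c + d * x$1]"
    using assms unfolding N0_rect_def by blast
  show ?thesis
    by (rule N0_rectI[of _ "s * a" "s * b" "s * c" "s * d"]) (simp add: u vec2_eq_iff algebra_simps)
qed

lemma local_space_scaleR: "u \<in> local_space K \<Longrightarrow> (\<lambda>x. s *\<^sub>R u x) \<in> local_space K"
  by (cases K) (simp_all add: N0_plus_scaleR N0_rect_scaleR)

text \<open>With gradients \<open>g\<close> and \<open>h\<close>, the linear part sends
  \<open>x\<close> to \<open>(g \<bullet> x) *\<^sub>R h - (h \<bullet> x) *\<^sub>R g\<close>. This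
  map is skew, hence a multiple of the quarter turn, with factor the determinant of \<open>g\<close>
  and \<open>h\<close>.\<close>

lemma whitney_form_in_N0_tri:
  assumes "nondegenerate v"
  shows "(\<lambda>x. bary v i x *\<^sub>R grad (bary v j) x - bary v j x *\<^sub>R grad (bary v i) x) \<in> N0_tri"
proof -
  define g h where "g = bary_grad v i" and "h = bary_grad v j"
  define p q where "p = g \<bullet> v$(i+1)" and "q = h \<bullet> v$(j+1)"
  have "bary v i x *\<^sub>R grad (bary v j) x - bary v j x *\<^sub>R grad (bary v i) x
    = vector [(q * g$1 - p * h$1) - (g$1 * h$2 - g$2 * h$1) * x$2,
              (q * g$2 - p * h$2) + (g$1 * h$2 - g$2 * h$1) * x$1]" for x
    unfolding grad_bary[OF assms] bary_eq[OF assms] inner_diff_right g_def[symmetric] h_def[symmetric]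
      p_def[symmetric] q_def[symmetric]
    by (simp add: vec2_eq_iff inner_vec2 algebra_simps)
  then show ?thesis unfolding N0_tri_def by blast
qed

lemma tri_edge_fun_in_N0_plus:
  assumes "nondegenerate v"
  shows "tri_edge_fun v \<alpha> \<beta> \<gamma> i \<in> N0_plus v"
  by (rule N0_plusI[OF whitney_form_in_N0_tri[OF assms, of i "i+1"],
        of _ "\<lambda>j. if j = i then \<alpha> i else if j = i + 1 then \<beta> i else \<gamma> i"])
    (simp add: tri_edge_fun_def sum_cyclic[of _ i])

lemma zero_in_N0_tri: "(\<lambda>_. 0) \<in> N0_tri"
  by (rule N0_triI[of _ 0 0 0]) (simp add: vec2_eq_iff)

lemma zero_in_local_space: "(\<lambda>_. 0) \<in> local_space K"
proof (cases K)
  case (Triangle v)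
  then show ?thesis using N0_plusI[OF zero_in_N0_tri, of _ "\<lambda>_. 0" v] by simp
next
  case (Rectangle a b)
  have "(\<lambda>_. 0) \<in> N0_rect" by (rule N0_rectI[of _ 0 0 0 0]) (simp add: vec2_eq_iff)
  with Rectangle show ?thesis by simp
qed

lemma tri_bubble_in_N0_plus: "tri_bubble v i \<in> N0_plus v"
  by (rule N0_plusI[OF zero_in_N0_tri, of _ "\<lambda>j. if j = i then 1 else 0"])
    (simp add: sum_cyclic[of _ i])

lemma continuous_on_vector_2:
  fixes f g :: "'a::topological_space \<Rightarrow> real"
  assumes "continuous_on S f" "continuous_on S g"
  shows "continuous_on S (\<lambda>x. vector [f x, g x] :: real^2)"
proof -
  have eq: "(\<lambda>x. vector [f x, g x] :: real^2) = (\<lambda>x. f x *\<^sub>R axis 1 1 + g x *\<^sub>R axis 2 1)"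
    by (simp add: fun_eq_iff vec2_eq_iff axis_def)
  show ?thesis unfolding eq using assms by (intro continuous_intros)
qed

text \<open>On a valid triangle the closed forms of the coordinates and gradients exhibit the
  bubbles as polynomials. Continuity serves to pass from the interior to the whole element.\<close>

lemma continuous_on_local_space:
  assumes "valid_element K" "u \<in> local_space K"
  shows "continuous_on S u"
proof (cases K)
  case (Triangle v)
  then have nd: "nondegenerate v" using assms(1) by simp
  obtain w c where w: "w \<in> N0_tri" "u = (\<lambda>x. w x + (\<Sum>i\<in>UNIV. c i *\<^sub>R tri_bubble v i x))"
    using assms(2) unfolding Triangle local_space.simps N0_plus_def by blast
  then obtain a b d where "w = (\<lambda>x. vector [a - b * x$2, d + b * x$1])"
    unfolding N0_tri_def by blast
  then have "continuous_on S w"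
    by (auto intro!: continuous_on_vector_2 continuous_intros)
  moreover have "continuous_on S (tri_bubble v i)" for i
  proof -
    have eq: "tri_bubble v i = (\<lambda>x. ((bary_grad v i \<bullet> (x - v$(i+1))) *
        (bary_grad v (i+1) \<bullet> (x - v$(i+2)))) *\<^sub>R bary_grad v (i+2))"
      by (simp add: fun_eq_iff tri_bubble_def grad_bary[OF nd] bary_eq[OF nd])
    show ?thesis unfolding eq by (intro continuous_intros)
  qed
  ultimately show ?thesis unfolding w by (intro continuous_intros)
next
  case (Rectangle a b)
  obtain p q r s where "u = (\<lambda>x. vector [p + q * x$2, r + s * x$1])"
    using assms(2) unfolding Rectangle local_space.simps N0_rect_def by blast
  then show ?thesis by (auto intro!: continuous_on_vector_2 continuous_intros)
qed

section \<open>From interior values to the closed element\<close>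

lemma nondegenerate_inj:
  assumes "nondegenerate v"
  shows "inj (($) v)"
proof (rule injI)
  fix i j assume eq: "v$i = v$j"
  have "v$i \<noteq> v$(i+1)" "v$i \<noteq> v$(i+2)"
    using tri_edge_nonzero[OF assms, of "i+2"] tri_edge_nonzero[OF assms, of "i+1"]
    unfolding right_minus_eq cyclic_simps by (metis, metis)
  with eq show "i = j" by (cases j i rule: cyclic_cases) metis+
qed

text \<open>A closed convex set with nonempty interior is the closure of that interior. Nonemptiness
  comes from three affinely independent vertices in the plane, or from the centre of the
  rectangle.\<close>

lemma region_eq_closure_interior:
  assumes "valid_element K"
  shows "region K = closure (interior (region K))"
proof -
  have "convex (region K)" "closed (region K)"
    by (cases K; simp add: convex_convex_hull compact_imp_closed finite_imp_compact_convex_hull)+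
  moreover have "interior (region K) \<noteq> {}"
  proof (cases K)
    case (Triangle v)
    then have nd: "nondegenerate v" using assms by simp
    have "card (range (($) v)) = Suc DIM(real^2)"
      using card_image[OF nondegenerate_inj[OF nd]] by simp
    moreover have "\<not> affine_dependent (range (($) v))"
      using nd unfolding nondegenerate_def range_vec3
      by (simp add: collinear_3_eq_affine_dependent)
    ultimately show ?thesis
      using Triangle interior_convex_hull_eq_empty[of "range (($) v)"] by simp
  next
    case (Rectangle a b)
    then have "midpoint a b \<in> box a b"
      using assms by (auto simp: proper_rect_def mem_box_cart forall_2 midpoint_def)
    then show ?thesis using Rectangle by auto
  qed
  ultimately show ?thesis using convex_closure_interior by fastforce
qed

text \<open>Whichever polynomial the choice operator selects, it agrees with \<open>p\<close> on the
  dense interior, hence by continuity on the element, including its boundary, where the quadrature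
  points lie.\<close>

lemma restriction_eq:
  assumes "valid_element K" "p \<in> local_space K" "\<And>x. x \<in> interior (region K) \<Longrightarrow> u x = p x"
    and "x \<in> region K"
  shows "restriction K u x = p x"
proof -
  let ?r = "restriction K u"
  have r: "?r \<in> local_space K \<and> (\<forall>x \<in> interior (region K). u x = ?r x)"
    unfolding restriction_def by (rule someI[of _ p]) (use assms in auto)
  let ?S = "closure (interior (region K))"
  have "?r x - p x = 0"
  proof (rule continuous_constant_on_closure[of "interior (region K)" "\<lambda>x. ?r x - p x"])
    show "continuous_on ?S (\<lambda>x. ?r x - p x)"
      using r assms(1,2) by (intro continuous_on_diff continuous_on_local_space) auto
    show "x \<in> ?S" using assms(4) region_eq_closure_interior[OF assms(1)] by simp
    show "restriction K u y - p y = 0" if "y \<in> interior (region K)" for y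
      using r assms(3) that by simp
  qed
  then show ?thesis by simp
qed

section \<open>Quadrature on one element\<close>

lemma tri_midpoint_in_region: "tri_midpoint v i \<in> region (Triangle v)"
proof -
  have "v$(i+1) \<in> region (Triangle v)" "v$(i+2) \<in> region (Triangle v)"
    by (simp_all add: hull_inc)
  moreover have "convex (region (Triangle v))" by simp
  ultimately show ?thesis
    unfolding tri_midpoint_def
    by (meson closed_segment_subset midpoint_in_closed_segment subsetD)
qed

lemma rect_midpoint_in_region:
  assumes "proper_rect a b"
  shows "rect_midpoint a b d \<in> region (Rectangle a b)"
  using assms
  by (cases d) (auto simp: rect_midpoint_def Let_def midpoint_def mem_box_cart forall_2 proper_rect_def
      field_simps)

lemma local_quad_cong:
  assumes "valid_element K"
    and "\<And>x. x \<in> region K \<Longrightarrow> u x = u' x" "\<And>x. x \<in> region K \<Longrightarrow> w x = w' x"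
  shows "local_quad K u w = local_quad K u' w'"
  using assms tri_midpoint_in_region rect_midpoint_in_region
  by (cases K) (simp_all del: region.simps)

lemma local_quad_scaleR:
  "local_quad K (\<lambda>x. s *\<^sub>R u x) (\<lambda>x. t *\<^sub>R w x) = s * t * local_quad K u w"
  by (cases K) (simp_all add: sum_2 sum_3 algebra_simps del: region.simps)

lemma local_quad_zero: "local_quad K (\<lambda>_. 0) w = 0" "local_quad K u (\<lambda>_. 0) = 0"
  by (cases K; simp)+

text \<open>Makes the edge number in \<open>local_edge_fun\<close> well defined: the vertices are
  distinct, and so are the pairs \<open>{i, i+1}\<close> modulo 3.\<close>

lemma endpoints_tri_edge_inj:
  assumes "nondegenerate v"
  shows "inj (\<lambda>i. endpoints (tri_edge v i))"
proof (rule injI)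
  fix i j assume "endpoints (tri_edge v i) = endpoints (tri_edge v j)"
  then have "(($) v) ` {i, i+1} = (($) v) ` {j, j+1}"
    by (simp add: endpoints_def tri_edge_def)
  then have "{i, i+1} = {j, j+1}"
    by (simp only: inj_image_eq_iff[OF nondegenerate_inj[OF assms]])
  then show "i = j"
    by (cases j i rule: cyclic_cases) (auto simp: doubleton_eq_iff)
qed

text \<open>Equal endpoint sets have equal midpoints, and the four edge midpoints of a proper
  rectangle are distinct.\<close>

lemma endpoints_rect_edge_inj:
  assumes "proper_rect a b"
  shows "inj (\<lambda>d. endpoints (rect_edge a b d))"
proof (rule injI)
  fix d d' assume "endpoints (rect_edge a b d) = endpoints (rect_edge a b d')"
  then have mid: "rect_midpoint a b d = rect_midpoint a b d'"
    by (auto simp: endpoints_def rect_midpoint_def doubleton_eq_iff midpoint_sym)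
  have index: "i = j" if "i = 1 \<longleftrightarrow> j = 1" for i j :: 2
    using that exhaust_2[of i] exhaust_2[of j] by auto
  show "d = d'"
    using mid assms
    by (cases d; cases d')
      (auto simp: rect_midpoint_def midpoint_def Let_def vec2_eq_iff proper_rect_def
        intro!: index split: if_splits)
qed

text \<open>Two elements meet at most in a segment, which has empty interior in the plane.\<close>

lemma mesh_interiors_disjoint:
  assumes "mesh \<Omega> T" "K \<in> T" "K' \<in> T" "K \<noteq> K'"
  shows "interior (region K) \<inter> interior (region K') = {}"
proof -
  have hull: "interior (convex hull {p, q}) = {}" for p q :: "real^2"
    by (rule empty_interior_convex_hull) (auto simp: card_insert_if)
  have edge: "\<exists>p q. e = {p, q}" if "e \<in> edges K" for e
    using that by (cases K) (auto simp: endpoints_def)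
  have "region K \<inter> region K' = {} \<or>
        (\<exists>p. region K \<inter> region K' = {p}) \<or>
        (\<exists>e \<in> edges K. region K \<inter> region K' = convex hull e)"
    using assms unfolding mesh_def by blast
  then have "interior (region K \<inter> region K') = {}"
    using hull edge by fastforce
  then show ?thesis by simp
qed


section \<open>Assembly\<close>

text \<open>The polynomial with which the global basis function of \<open>d\<close> coincides inside
  \<open>K\<close>; it is zero if \<open>d\<close> does not belong to \<open>K\<close>.\<close>

definition local_dof_fun ::
  "(real^2^3 \<Rightarrow> 3 \<Rightarrow> real) \<Rightarrow> (real^2^3 \<Rightarrow> 3 \<Rightarrow> real) \<Rightarrow> (real^2^3 \<Rightarrow> 3 \<Rightarrow> real) \<Rightarrow>
   ((real^2) set \<Rightarrow> (real^2) \<times> (real^2)) \<Rightarrow> element \<Rightarrow> dof \<Rightarrow> vfield" where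
  "local_dof_fun \<alpha> \<beta> \<gamma> ori K d = (case d of
     Edge_Dof e \<Rightarrow> if e \<in> edges K
       then (\<lambda>y. edge_sign (ori e) (local_edge_fun \<alpha> \<beta> \<gamma> e K) *\<^sub>R local_edge_fun \<alpha> \<beta> \<gamma> e K y)
       else (\<lambda>_. 0)
   | Bubble_Dof v i \<Rightarrow> if K = Triangle v then tri_bubble v i else (\<lambda>_. 0))"

lemma local_edge_fun_in_local_space:
  assumes "valid_element K"
  shows "local_edge_fun \<alpha> \<beta> \<gamma> e K \<in> local_space K"
  using assms
  by (cases K) (simp_all add: tri_edge_fun_in_N0_plus rect_basis_in_N0_rect del: rect_basis.simps)

lemma local_dof_fun_in_local_space:
  assumes "valid_element K"
  shows "local_dof_fun \<alpha> \<beta> \<gamma> ori K d \<in> local_space K"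
  using local_edge_fun_in_local_space[OF assms]
  by (auto simp: local_dof_fun_def tri_bubble_in_N0_plus zero_in_local_space
      intro: local_space_scaleR split: dof.split)

lemma zero_ext_mesh:
  assumes "mesh \<Omega> T" "K \<in> T" "K' \<in> T" "x \<in> interior (region K)"
  shows "zero_ext K' F x = (if K' = K then F x else 0)"
  using mesh_interiors_disjoint[OF assms(1-3)] assms(4) by (auto simp: zero_ext_def)

lemma global_basis_eq_local_dof_fun:
  assumes "mesh \<Omega> T" "K \<in> T" "d \<in> dofs T" "x \<in> interior (region K)"
  shows "global_basis T \<alpha> \<beta> \<gamma> ori d x = local_dof_fun \<alpha> \<beta> \<gamma> ori K d x"
proof (cases d)
  case (Edge_Dof e)
  let ?f = "\<lambda>K y. edge_sign (ori e) (local_edge_fun \<alpha> \<beta> \<gamma> e K) *\<^sub>R local_edge_fun \<alpha> \<beta> \<gamma> e K y"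
  have fin: "finite {K' \<in> T. e \<in> edges K'}" using assms(1) by (simp add: mesh_def)
  have "global_basis T \<alpha> \<beta> \<gamma> ori d x = (\<Sum>K' \<in> {K' \<in> T. e \<in> edges K'}. zero_ext K' (?f K') x)"
    by (simp add: Edge_Dof)
  \<comment> \<open>Interiors are disjoint, so only the summand of \<open>K\<close> can survive; it
    occurs exactly if \<open>e\<close> is an edge of \<open>K\<close>.\<close>
  also have "\<dots> = (\<Sum>K' \<in> {K' \<in> T. e \<in> edges K'}. if K' = K then ?f K x else 0)"
    by (rule sum.cong) (auto simp: zero_ext_mesh[OF assms(1,2) _ assms(4)])
  also have "\<dots> = local_dof_fun \<alpha> \<beta> \<gamma> ori K d x"
    using fin assms(2) by (simp add: Edge_Dof local_dof_fun_def)
  finally show ?thesis .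
next
  case (Bubble_Dof v i)
  then have "Triangle v \<in> T" using assms(3) by (auto simp: dofs_def)
  then show ?thesis
    using zero_ext_mesh[OF assms(1,2) _ assms(4)] by (auto simp: Bubble_Dof local_dof_fun_def)
qed

lemma f_the_eq:
  assumes "inj f" "e \<in> range f"
  shows "f (THE i. f i = e) = e"
  using assms theI[of "\<lambda>i. f i = e"] by (auto dest: injD)

text \<open>The scalar absorbs the orientation sign. The equation for \<open>d\<close> recovers the
  global degree of freedom from the local one, so different global ones have different local
  ones.\<close>

lemma local_dof_fun_tri:
  assumes "nondegenerate v"
  shows "local_dof_fun \<alpha> \<beta> \<gamma> ori (Triangle v) d = (\<lambda>_. 0) \<or>
    (\<exists>s p. local_dof_fun \<alpha> \<beta> \<gamma> ori (Triangle v) d = (\<lambda>x. s *\<^sub>R tri_basis v (\<alpha> v) (\<beta> v) (\<gamma> v) p x) \<and>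
      d = (case p of Tri_Edge i \<Rightarrow> Edge_Dof (endpoints (tri_edge v i)) | Tri_Bubble i \<Rightarrow> Bubble_Dof v i))"
proof (cases d)
  case (Edge_Dof e)
  then show ?thesis
    using f_the_eq[OF endpoints_tri_edge_inj[OF assms], of e]
    by (cases "e \<in> edges (Triangle v)")
      (auto simp: local_dof_fun_def
        intro!: exI[of _ "Tri_Edge (THE i. endpoints (tri_edge v i) = e)"])
next
  case (Bubble_Dof w i)
  then show ?thesis
    by (cases "w = v") (auto simp: local_dof_fun_def intro!: exI[of _ 1] exI[of _ "Tri_Bubble i"])
qed

lemma local_dof_fun_rect:
  assumes "proper_rect a b"
  shows "local_dof_fun \<alpha> \<beta> \<gamma> ori (Rectangle a b) d = (\<lambda>_. 0) \<or>
    (\<exists>s p. local_dof_fun \<alpha> \<beta> \<gamma> ori (Rectangle a b) d = (\<lambda>x. s *\<^sub>R rect_basis a b p x) \<and>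
      d = Edge_Dof (endpoints (rect_edge a b p)))"
proof (cases d)
  case (Edge_Dof e)
  then show ?thesis
    using f_the_eq[OF endpoints_rect_edge_inj[OF assms], of e]
    by (cases "e \<in> edges (Rectangle a b)")
      (auto simp: local_dof_fun_def
        intro!: exI[of _ "THE d. endpoints (rect_edge a b d) = e"])
next
  case (Bubble_Dof w i)
  then show ?thesis by (simp add: local_dof_fun_def)
qed

text \<open>If neither function is zero, both are multiples of local basis functions with different
  indices, and bilinearity reduces the claim to an off-diagonal local entry.\<close>

lemma local_dof_funs_orthogonal:
  assumes "valid_element K" "d \<noteq> d'"
    and normal: "\<And>v. K = Triangle v \<Longrightarrow> normal_components_vanish v (\<alpha> v) (\<beta> v) (\<gamma> v)"
  shows "local_quad K (local_dof_fun \<alpha> \<beta> \<gamma> ori K d) (local_dof_fun \<alpha> \<beta> \<gamma> ori K d') = 0"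
    (is "local_quad K (?f d) (?f d') = 0")
proof (cases "?f d = (\<lambda>_. 0) \<or> ?f d' = (\<lambda>_. 0)")
  case True
  then show ?thesis by (elim disjE) (simp_all only: local_quad_zero)
next
  case nz: False
  show ?thesis
  proof (cases K)
    case (Triangle v)
    then have nd: "nondegenerate v" using assms(1) by simp
    let ?b = "tri_basis v (\<alpha> v) (\<beta> v) (\<gamma> v)"
    obtain s t p q where f: "?f d = (\<lambda>x. s *\<^sub>R ?b p x)" "?f d' = (\<lambda>x. t *\<^sub>R ?b q x)" and "p \<noteq> q"
      using nz local_dof_fun_tri[OF nd] assms(2) unfolding Triangle by metis
    then have "local_quad K (?b p) (?b q) = 0"
      using tri_mass_matrix_diagonal[OF nd normal] Triangle
      unfolding diagonal_on_def gram_def by blast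
    then show ?thesis unfolding f local_quad_scaleR by simp
  next
    case (Rectangle a b)
    then have r: "proper_rect a b" using assms(1) by simp
    let ?b = "rect_basis a b"
    obtain s t p q where f: "?f d = (\<lambda>x. s *\<^sub>R ?b p x)" "?f d' = (\<lambda>x. t *\<^sub>R ?b q x)" and "p \<noteq> q"
      using nz local_dof_fun_rect[OF r] assms(2) unfolding Rectangle by metis
    then have "local_quad K (?b p) (?b q) = 0"
      using rect_mass_matrix_diagonal[OF r] Rectangle
      unfolding diagonal_on_def gram_def by blast
    then show ?thesis unfolding f local_quad_scaleR by simp
  qed
qed

text \<open>The contribution of each element vanishes separately.\<close>

lemma global_mass_matrix_diagonal:
  assumes "mesh \<Omega> T"
    and "\<And>v. Triangle v \<in> T \<Longrightarrow> normal_components_vanish v (\<alpha> v) (\<beta> v) (\<gamma> v)"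
  shows "diagonal_on (dofs T) (gram (global_quad T) (global_basis T \<alpha> \<beta> \<gamma> ori))"
  unfolding diagonal_on_def gram_def global_quad_def
proof (intro ballI impI sum.neutral)
  fix d d' K assume d: "d \<in> dofs T" "d' \<in> dofs T" "d \<noteq> d'" and K: "K \<in> T"
  then have valid: "valid_element K" using assms(1) by (simp add: mesh_def)
  let ?r = "\<lambda>d. restriction K (global_basis T \<alpha> \<beta> \<gamma> ori d)"
  \<comment> \<open>Agreement in the interior extends to the closed element, hence to the quadrature
    points.\<close>
  have r: "?r d x = local_dof_fun \<alpha> \<beta> \<gamma> ori K d x" if "d \<in> dofs T" "x \<in> region K" for d x
    using that valid local_dof_fun_in_local_space global_basis_eq_local_dof_fun[OF assms(1) K]
    by (intro restriction_eq) auto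
  have "local_quad K (?r d) (?r d')
      = local_quad K (local_dof_fun \<alpha> \<beta> \<gamma> ori K d) (local_dof_fun \<alpha> \<beta> \<gamma> ori K d')"
    using r d by (intro local_quad_cong[OF valid]) auto
  also have "\<dots> = 0"
    using valid d(3) assms(2) K by (intro local_dof_funs_orthogonal) auto
  finally show "local_quad K (?r d) (?r d') = 0" .
qed

theorem mainTheorem2:
  shows "(\<forall>v. nondegenerate v \<longrightarrow>
            (\<exists>\<alpha> \<beta> \<gamma>. normal_components_vanish v \<alpha> \<beta> \<gamma>) \<and>
            (\<forall>\<alpha> \<beta> \<gamma>. normal_components_vanish v \<alpha> \<beta> \<gamma> \<longrightarrow>
               diagonal_on UNIV (gram (local_quad (Triangle v)) (tri_basis v \<alpha> \<beta> \<gamma>))))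
       \<and> (\<forall>a b. proper_rect a b \<longrightarrow>
            diagonal_on UNIV (gram (local_quad (Rectangle a b)) (rect_basis a b)))
       \<and> (\<forall>\<Omega> T ori \<alpha> \<beta> \<gamma>.
            bounded_lipschitz_polygon \<Omega> \<and> mesh \<Omega> T \<and> edge_orientation T ori \<and>
            (\<forall>v. Triangle v \<in> T \<longrightarrow> normal_components_vanish v (\<alpha> v) (\<beta> v) (\<gamma> v)) \<longrightarrow>
            diagonal_on (dofs T) (gram (global_quad T) (global_basis T \<alpha> \<beta> \<gamma> ori)))"
  using normal_components_vanish_exists tri_mass_matrix_diagonal rect_mass_matrix_diagonal
    global_mass_matrix_diagonal
  by (intro conjI allI impI) blast+

end
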